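(* Let $E$ be an arbitrary directed graph. The following conditions are equivalent. (1) No nonzero element of $F_E^\Gamma$ is periodic. (2) The graph $E$ satisfies Condition (L), i.e. every cycle of $E$ has an exit.
   Context: Setup. $\Gamma=\{x^n\mid n\in\mathbb Z\}$ is the infinite cyclic group generated by $x$. $E$ is an arbitrary directed graph with vertex set $E^0$, edge set $E^1$, source map $\mathbf s$ and range map $\mathbf r$. A vertex $v$ is regular if $\mathbf s^{-1}(v)$ is finite and nonempty, and an infinite emitter if $\mathbf s^{-1}(v)$ is infinite. For every infinite emitter $v$ and every finite nonempty $Z\subseteq \mathbf s^{-1}(v)$ introduce a symbol $q_Z=q_Z^v$, called an improper vertex; elements of $E^0$ are called proper vertices. $F_E^\Gamma$ is the free commutative $\Gamma$-monoid on all proper and improper vertices (these are called the generators): its elements are finite formal sums of monomials $x^m g$ ($m\in\mathbb Z$, $g$ a generator), and $x^n$ acts by $x^n(x^m g)=x^{n+m}g$. The relation $\to_1$ on $F_E^\Gamma-\{0\}$ is given, for all $a\in F_E^\Gamma$ and $m\in\mathbb Z$, by: (A1) $a+x^m v\to_1 a+\sum_{e\in \mathbf s^{-1}(v)}x^{m+1}\mathbf r(e)$ for $v$ regular; (A2) $a+x^m v\to_1 a+x^m q_Z+\sum_{e\in Z}x^{m+1}\mathbf r(e)$ for $v$ an infinite emitter and $Z\subseteq \mathbf s^{-1}(v)$ finite and nonempty; (A3) $a+x^m q_Z\to_1 a+x^m q_W+\sum_{e\in W-Z}x^{m+1}\mathbf r(e)$ for $v$ an infinite emitter and finite nonempty $Z\subsetneq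 W\subseteq \mathbf s^{-1}(v)$. $\sim$ is the congruence on $F_E^\Gamma$ generated by $\to_1$. An element $a\in F_E^\Gamma$ is periodic if $a\sim x^n a$ for some positive integer $n$. A cycle is a closed path $e_1\cdots e_n$, $n\geq 1$, with $\mathbf s(e_i)\neq \mathbf s(e_j)$ for $i\ne j$. A cycle has an exit if some vertex on it emits an edge which is not on the cycle. *)

theory Defs
  imports "Graph_Theory.Arc_Walk" "HOL-Library.Multiset"
begin

text \<open>
  Graphs are the directed multigraphs of \<^locale>\<open>wf_digraph\<close>: vertex and edge sets are arbitrary
  (possibly empty or infinite), loops and parallel edges are allowed, and
  \<^const>\<open>out_arcs\<close> is the preimage of a vertex under the source map.
\<close>

definition regular :: "('v, 'e) pre_digraph \<Rightarrow> 'v \<Rightarrow> bool" where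
  "regular E v \<longleftrightarrow> v \<in> verts E \<and> finite (out_arcs E v) \<and> out_arcs E v \<noteq> {}"

definition infinite_emitter :: "('v, 'e) pre_digraph \<Rightarrow> 'v \<Rightarrow> bool" where
  "infinite_emitter E v \<longleftrightarrow> v \<in> verts E \<and> infinite (out_arcs E v)"

datatype ('v, 'e) generator = Proper 'v | Improper 'v "'e set"

definition generators :: "('v, 'e) pre_digraph \<Rightarrow> ('v, 'e) generator set" where
  "generators E = Proper ` verts E \<union>
     {Improper v Z | v Z. infinite_emitter E v \<and> finite Z \<and> Z \<noteq> {} \<and> Z \<subseteq> out_arcs E v}"

text \<open>
  The group is written additively through its exponents: the pair \<open>(m, g)\<close> stands for the
  monomial \<open>x^m g\<close>, and multisets of such pairs (with \<open>{#}\<close> as zero) for formal sums of monomials.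
\<close>

type_synonym ('v, 'e) gmon = "(int \<times> ('v, 'e) generator) multiset"

definition graph_gmonoid :: "('v, 'e) pre_digraph \<Rightarrow> ('v, 'e) gmon set" where
  "graph_gmonoid E = {a. set_mset a \<subseteq> UNIV \<times> generators E}"

definition act :: "int \<Rightarrow> ('v, 'e) gmon \<Rightarrow> ('v, 'e) gmon" where
  "act n a = image_mset (\<lambda>(m, g). (n + m, g)) a"

inductive step1 :: "('v, 'e) pre_digraph \<Rightarrow> ('v, 'e) gmon \<Rightarrow> ('v, 'e) gmon \<Rightarrow> bool"
  for E where
  A1: "a \<in> graph_gmonoid E \<Longrightarrow> regular E v \<Longrightarrow>
    step1 E (a + {#(m, Proper v)#})
            (a + (\<Sum>e\<in>out_arcs E v. {#(m + 1, Proper (head E e))#}))"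
| A2: "a \<in> graph_gmonoid E \<Longrightarrow> infinite_emitter E v \<Longrightarrow>
    finite Z \<Longrightarrow> Z \<noteq> {} \<Longrightarrow> Z \<subseteq> out_arcs E v \<Longrightarrow>
    step1 E (a + {#(m, Proper v)#})
            (a + {#(m, Improper v Z)#} + (\<Sum>e\<in>Z. {#(m + 1, Proper (head E e))#}))"
| A3: "a \<in> graph_gmonoid E \<Longrightarrow> infinite_emitter E v \<Longrightarrow>
    finite W \<Longrightarrow> Z \<noteq> {} \<Longrightarrow> Z \<subset> W \<Longrightarrow> W \<subseteq> out_arcs E v \<Longrightarrow>
    step1 E (a + {#(m, Improper v Z)#})
            (a + {#(m, Improper v W)#} + (\<Sum>e\<in>W - Z. {#(m + 1, Proper (head E e))#}))"

text \<open>The least congruence of commutative monoids with group action that contains \<^const>\<open>step1\<close>:\<close>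

inductive gcong :: "('v, 'e) pre_digraph \<Rightarrow> ('v, 'e) gmon \<Rightarrow> ('v, 'e) gmon \<Rightarrow> bool"
  for E where
  step: "step1 E a b \<Longrightarrow> gcong E a b"
| refl: "a \<in> graph_gmonoid E \<Longrightarrow> gcong E a a"
| sym: "gcong E a b \<Longrightarrow> gcong E b a"
| trans: "gcong E a b \<Longrightarrow> gcong E b c \<Longrightarrow> gcong E a c"
| add: "gcong E a b \<Longrightarrow> gcong E c d \<Longrightarrow> gcong E (a + c) (b + d)"
| act: "gcong E a b \<Longrightarrow> gcong E (act n a) (act n b)"

definition periodic :: "('v, 'e) pre_digraph \<Rightarrow> ('v, 'e) gmon \<Rightarrow> bool" where
  "periodic E a \<longleftrightarrow> (\<exists>n>0. gcong E a (act n a))"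

text \<open>
  The library's \<open>cycle\<close> asks for pairwise distinct vertices after the first one, that is, for
  distinct ranges of the edges. For closed walks this is the same as distinct sources.
\<close>

lemma (in wf_digraph) cycle_iff_distinct_tails:
  "cycle p \<longleftrightarrow> p \<noteq> [] \<and> (\<exists>u. awalk u p u) \<and> distinct (map (tail G) p)"
proof -
  have verts: "awalk_verts u p = map (tail G) p @ [v]" if "cas u p v" for u v p
    using that by (induction p arbitrary: u) auto
  have "distinct (tl (awalk_verts u p)) \<longleftrightarrow> distinct (map (tail G) p)"
    if w: "awalk u p u" and ne: "p \<noteq> []" for u
  proof -
    from w have "cas u p u" by (simp add: awalk_def)
    moreover obtain e es where "p = e # es" using ne by (cases p) auto
    ultimately show ?thesis using verts[of u p u] by auto
  qed
  then show ?thesis unfolding cycle_def by blast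
qed

definition has_exit :: "('v, 'e) pre_digraph \<Rightarrow> 'e list \<Rightarrow> bool" where
  "has_exit E p \<longleftrightarrow> (\<exists>v \<in> tail E ` set p. \<exists>e \<in> out_arcs E v. e \<notin> set p)"

definition condition_L :: "('v, 'e) pre_digraph \<Rightarrow> bool" where
  "condition_L E \<longleftrightarrow> (\<forall>p. pre_digraph.cycle E p \<longrightarrow> has_exit E p)"

end

theory Submission
  imports Defs
begin

text \<open>
  Walking once around an exitless cycle of length \<open>n\<close> turns \<open>v\<close> into \<open>x^n v\<close>, so \<open>v\<close> is periodic.

  Conversely, only finitely many edges enter a derivation of \<open>a \<sim> x^n a\<close>. Cut every infinite
  emitter down to a finite set \<open>S\<close> of edges containing these: \<open>v\<close> becomes \<open>q_Z\<close> plus the ranges of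
  the edges in \<open>Z = S \<inter> s^{-1}(v)\<close>, and \<open>q_Z\<close> becomes a sink. Now expansion is deterministic, and
  expanding everything below a high level \<open>m\<close> gives the same result for all elements of the derivation. So the
  expansion of \<open>a\<close> up to level \<open>m + n\<close> is \<open>x^n\<close> times the one up to level \<open>m\<close>. Expansion never
  decreases the number of monomials, hence this number is eventually constant, and sinks are
  impossible because their levels do not move. So eventually every monomial is a proper vertex
  emitting exactly one edge, and following these edges inside the finite set of vertices that
  recurs every \<open>n\<close> levels gives a cycle without exit.
\<close>

section \<open>Exitless cycles give periodic elements\<close>

lemma act_empty [simp]: "act n {#} = {#}"
  and act_add: "act n (a + b) = act n a + act n b"
  and act_single [simp]: "act n {#(m, g)#} = {#(n + m, g)#}"
  and act_add_mset [simp]: "act n (add_mset (m, g) a) = add_mset (n + m, g) (act n a)"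
  and size_act [simp]: "size (act n a) = size a"
  by (simp_all add: act_def)

lemma mem_act_iff: "(k, g) \<in># act n a \<longleftrightarrow> (k - n, g) \<in># a"
  by (force simp: act_def image_iff)

lemma act_act: "act m (act n a) = act (m + n) a"
  by (simp add: act_def multiset.map_comp comp_def case_prod_unfold add.assoc)

lemma act_zero [simp]: "act 0 a = a"
  by (simp add: act_def case_prod_beta)

text \<open>Each arc is the only one leaving its tail, so the sum in \<open>A1\<close> has a single
  term and every step of the walk raises the exponent by 1.\<close>

lemma (in wf_digraph) gcong_along_exitless_walk:
  assumes "awalk u p w" "\<And>e. e \<in> set p \<Longrightarrow> out_arcs G (tail G e) = {e}"
  shows "gcong G {#(m, Proper u)#} {#(m + int (length p), Proper w)#}"
  using assms
proof (induction p arbitrary: u m)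
  case Nil
  then have "u = w" "u \<in> verts G" by (auto simp: awalk_def)
  then show ?case by (auto intro!: gcong.refl simp: graph_gmonoid_def generators_def)
next
  case (Cons e p)
  then have e: "tail G e = u" "e \<in> arcs G" "awalk (head G e) p w"
    by (auto simp: awalk_Cons_iff)
  have out: "out_arcs G u = {e}" using Cons.prems(2)[of e] e(1) by simp
  have "regular G u" using out e(1) tail_in_verts[OF e(2)] by (simp add: regular_def)
  then have "step1 G ({#} + {#(m, Proper u)#})
      ({#} + (\<Sum>e\<in>out_arcs G u. {#(m + 1, Proper (head G e))#}))"
    by (intro step1.A1) (auto simp: graph_gmonoid_def)
  then have "gcong G {#(m, Proper u)#} {#(m + 1, Proper (head G e))#}"
    using out by (auto intro: gcong.step)
  moreover have "gcong G {#(m + 1, Proper (head G e))#} {#(m + 1 + int (length p), Proper w)#}"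
    using Cons.IH[OF e(3)] Cons.prems(2) by simp
  ultimately show ?case by (auto intro: gcong.trans simp: algebra_simps)
qed

lemma (in wf_digraph) exitless_cycle_periodic:
  assumes "cycle p" "\<not> has_exit G p"
  shows "\<exists>a \<in> graph_gmonoid G. a \<noteq> {#} \<and> periodic G a"
proof -
  obtain u where p: "p \<noteq> []" "awalk u p u" "distinct (map (tail G) p)"
    using assms(1) by (auto simp: cycle_iff_distinct_tails)
  have "out_arcs G (tail G e) = {e}" if e: "e \<in> set p" for e
  proof -
    \<comment> \<open>Without an exit \<open>f\<close> lies on \<open>p\<close> too, and an arc of a
      cycle is determined by its tail.\<close>
    have "f = e" if f: "f \<in> out_arcs G (tail G e)" for f
    proof -
      have "f \<in> set p" using assms(2) e f by (auto simp: has_exit_def)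
      moreover have "tail G f = tail G e" using f by simp
      ultimately show ?thesis using p(3) e by (auto simp: distinct_map dest: inj_onD)
    qed
    moreover have "e \<in> arcs G" using p(2) e by (auto simp: awalk_def)
    ultimately show ?thesis by auto
  qed
  then have "gcong G {#(0, Proper u)#} (act (int (length p)) {#(0, Proper u)#})"
    using gcong_along_exitless_walk[OF p(2), of 0] by simp
  then have "periodic G {#(0, Proper u)#}"
    unfolding periodic_def using p(1) by (intro exI[of _ "int (length p)"]) simp
  moreover have "{#(0, Proper u)#} \<in> graph_gmonoid G"
    using p(2) by (auto simp: awalk_def graph_gmonoid_def generators_def)
  ultimately show ?thesis by (intro bexI[of _ "{#(0, Proper u)#}"]) simp_all
qed

section \<open>Expansion by levels\<close>

abbreviation fan :: "('v, 'e) pre_digraph \<Rightarrow> int \<Rightarrow> 'e set \<Rightarrow> ('v, 'e) gmon" where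
  "fan E k A \<equiv> \<Sum>e\<in>A. {#(k + 1, Proper (head E e))#}"

text \<open>\<open>Improper v Z\<close> has already released the edges of \<open>Z\<close>, so only
  the rest is emitted. The symbol reached does not depend on \<open>Z\<close> and unfolds to itself.
  If \<open>S\<close> misses all edges at \<open>v\<close>, it lies outside
  \<open>generators E\<close>; this is harmless, since expansions are only compared with each
  other.\<close>

fun unfold :: "('v, 'e) pre_digraph \<Rightarrow> 'e set \<Rightarrow> int \<times> ('v, 'e) generator \<Rightarrow> ('v, 'e) gmon" where
  "unfold E S (k, Proper v) =
     (if out_arcs E v = {} then {#(k, Proper v)#}
      else if finite (out_arcs E v) then fan E k (out_arcs E v)
      else {#(k, Improper v (S \<inter> out_arcs E v))#} + fan E k (S \<inter> out_arcs E v))"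
| "unfold E S (k, Improper v Z) =
     {#(k, Improper v (S \<inter> out_arcs E v))#} + fan E k (S \<inter> out_arcs E v - Z)"

text \<open>Restricting to one level makes the fans, which land on level \<open>m + 1\<close>, wait
  for the next pass.\<close>

definition advance :: "('v, 'e) pre_digraph \<Rightarrow> 'e set \<Rightarrow> int \<Rightarrow> ('v, 'e) gmon \<Rightarrow> ('v, 'e) gmon" where
  "advance E S m a = (\<Sum>t\<in>#a. if fst t = m then unfold E S t else {#t#})"

text \<open>Unfolds the levels from \<open>L\<close> to \<open>L + j - 1\<close> and leaves alone whatever lies below \<open>L\<close>.\<close>

primrec expand ::
  "('v, 'e) pre_digraph \<Rightarrow> 'e set \<Rightarrow> int \<Rightarrow> nat \<Rightarrow> ('v, 'e) gmon \<Rightarrow> ('v, 'e) gmon" where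
  "expand E S L 0 a = a"
| "expand E S L (Suc j) a = advance E S (L + int j) (expand E S L j a)"

lemma mem_fanD: "(l, g) \<in># fan E k A \<Longrightarrow> l = k + 1"
  by (induction A rule: infinite_finite_induct) auto

lemma size_fan [simp]: "size (fan E k A) = card A"
  by (simp add: size_multiset_sum)

lemma act_fan: "act n (fan E k A) = fan E (n + k) A"
  by (induction A rule: infinite_finite_induct) (simp_all add: act_add add.assoc)

lemma fan_diff:
  fixes E :: "('v, 'e) pre_digraph"
  assumes "finite B" "A \<subseteq> B"
  shows "fan E k (B - A) + fan E k A = (fan E k B :: ('v, 'e) gmon)"
  using sum.subset_diff[OF assms(2,1), of "\<lambda>e. {#(k + 1, Proper (head E e) :: ('v, 'e) generator)#}"] by simp

lemma mem_unfold_level: "(l, h) \<in># unfold E S (k, g) \<Longrightarrow> l = k \<or> l = k + 1"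
  by (cases g) (auto split: if_splits dest: mem_fanD)

lemma size_unfold_pos: "0 < size (unfold E S t)"
  by (cases "(E, S, t)" rule: unfold.cases) (auto simp: card_gt_0_iff)

lemma act_unfold: "act n (unfold E S (k, g)) = unfold E S (n + k, g)"
  by (cases g) (auto simp: act_add act_fan)

lemma advance_empty [simp]: "advance E S m {#} = {#}"
  and advance_add: "advance E S m (a + b) = advance E S m a + advance E S m b"
  and advance_single: "advance E S m {#t#} = (if fst t = m then unfold E S t else {#t#})"
  by (simp_all add: advance_def)

lemma advance_cong_id: "(\<And>k g. (k, g) \<in># a \<Longrightarrow> k \<noteq> m) \<Longrightarrow> advance E S m a = a"
  by (induction a) (force simp: advance_def)+

lemma advance_fan [simp]: "advance E S k (fan E k A) = fan E k A"
  by (rule advance_cong_id) (auto dest: mem_fanD)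

lemma act_advance: "act n (advance E S m a) = advance E S (n + m) (act n a)"
proof (induction a)
  case (add t a)
  have "act n (advance E S m {#t#}) = advance E S (n + m) (act n {#t#})"
    by (cases t) (simp add: advance_single act_unfold)
  with add show ?case
    using advance_add[of E S m "{#t#}" a] advance_add[of E S "n + m" "act n {#t#}" "act n a"]
      act_add[of n "{#t#}" a] by (simp add: act_add)
qed simp

lemma expand_empty [simp]: "expand E S L j {#} = {#}"
  by (induction j) simp_all

lemma expand_add: "expand E S L j (a + b) = expand E S L j a + expand E S L j b"
  by (induction j) (simp_all add: advance_add)

lemma act_expand: "act n (expand E S L j a) = expand E S (n + L) j (act n a)"
  by (induction j) (simp_all add: act_advance add.assoc)

lemma expand_split: "expand E S L (i + j) a = expand E S (L + int i) j (expand E S L i a)"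
  by (induction j) (simp_all add: add.assoc)

lemma expand_below:
  assumes "\<And>k g. (k, g) \<in># a \<Longrightarrow> L + int j \<le> k"
  shows "expand E S L j a = a"
  using assms
proof (induction j)
  case (Suc j)
  then have "expand E S L j a = a" by force
  moreover have "advance E S (L + int j) a = a"
    using Suc.prems by (intro advance_cong_id) fastforce
  ultimately show ?case by simp
qed simp

section \<open>Invariance of expansion under the congruence\<close>

lemma expand_eqI:
  assumes "advance E S k b = advance E S k c"
    and "\<And>l g. (l, g) \<in># b + c \<Longrightarrow> k \<le> l"
    and "L \<le> k" "k + 1 \<le> L + int j"
  shows "expand E S L j b = expand E S L j c"
proof -
  \<comment> \<open>The window splits into \<open>i\<close> passes below level \<open>k\<close>,
    which fix both sides, the pass at \<open>k\<close>, which merges them, and the rest.\<close>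
  define i where "i = nat (k - L)"
  have i: "L + int i = k" using assms(3) by (simp add: i_def)
  have "\<exists>i'. j = i + (Suc 0 + i')" using assms(4) i by presburger
  then obtain i' where j: "j = i + (Suc 0 + i')" ..
  have "expand E S L i b = b" "expand E S L i c = c"
    using assms(2) i by (auto intro!: expand_below)
  then show ?thesis
    unfolding j expand_split using i assms(1) by simp
qed

text \<open>One side arises from the other by unfolding a monomial at level \<open>k\<close>,
  perhaps only partially; a window containing \<open>k\<close> completes both to the same result.
  \<open>S\<close> must contain the edges chosen by the rule, so \<open>X\<close> is
  \<open>{}\<close>, \<open>Z\<close> or \<open>W\<close>.\<close>

lemma expand_step1:
  assumes "step1 E a b"
  shows "\<exists>X. finite X \<and> (\<exists>k. \<forall>S. X \<subseteq> S \<longrightarrow> finite S \<longrightarrow> (\<forall>L\<le>k. \<forall>j. k + 1 \<le> L + int j \<longrightarrow>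
    expand E S L j a = expand E S L j b))"
  using assms
proof cases
  case (A1 c v k)
  let ?F = "fan E k (out_arcs E v)"
  have "advance E S k {#(k, Proper v)#} = advance E S k ?F" for S
    using A1(4) by (simp add: advance_single regular_def)
  then have "expand E S L j {#(k, Proper v)#} = expand E S L j ?F"
    if "L \<le> k" "k + 1 \<le> L + int j" for S L j
    by (rule expand_eqI) (use that in \<open>auto dest: mem_fanD\<close>)
  then show ?thesis
    unfolding A1(1,2) by (intro exI[of _ "{}"] conjI exI[of _ k]) (simp_all only: expand_add, simp_all)
next
  case (A2 c v Z k)
  let ?F = "{#(k, Improper v Z)#} + fan E k Z"
  have "expand E S L j {#(k, Proper v)#} = expand E S L j ?F"
    if "Z \<subseteq> S" "finite S" "L \<le> k" "k + 1 \<le> L + int j" for S L j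
  proof -
    \<comment> \<open>The edges that \<open>Improper v Z\<close> still owes and those released by
      \<open>A2\<close> cover \<open>S \<inter> out_arcs E v\<close> exactly once.\<close>
    have "fan E k (S \<inter> out_arcs E v - Z) + fan E k Z = fan E k (S \<inter> out_arcs E v)"
      by (rule fan_diff) (use that A2 in auto)
    then have "advance E S k {#(k, Proper v)#} = advance E S k ?F"
      using A2(4) unfolding advance_add by (auto simp: advance_single infinite_emitter_def)
    then show ?thesis by (rule expand_eqI) (use that in \<open>auto dest: mem_fanD\<close>)
  qed
  then show ?thesis
    unfolding A2(1,2) add.assoc
    by (intro exI[of _ Z] conjI exI[of _ k]) (simp_all only: expand_add A2(5), simp_all)
next
  case (A3 c v W Z k)
  let ?F = "{#(k, Improper v W)#} + fan E k (W - Z)"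
  have "expand E S L j {#(k, Improper v Z)#} = expand E S L j ?F"
    if "W \<subseteq> S" "finite S" "L \<le> k" "k + 1 \<le> L + int j" for S L j
  proof -
    have eq: "(S \<inter> out_arcs E v - Z) - (W - Z) = S \<inter> out_arcs E v - W"
      using A3 by auto
    have "fan E k (S \<inter> out_arcs E v - W) + fan E k (W - Z) = fan E k (S \<inter> out_arcs E v - Z)"
      unfolding eq[symmetric] by (rule fan_diff) (use that A3 in auto)
    then have "advance E S k {#(k, Improper v Z)#} = advance E S k ?F"
      unfolding advance_add by (auto simp: advance_single)
    then show ?thesis by (rule expand_eqI) (use that in \<open>auto dest: mem_fanD\<close>)
  qed
  then show ?thesis
    unfolding A3(1,2) add.assoc
    by (intro exI[of _ W] conjI exI[of _ k]) (simp_all only: expand_add A3(5), simp_all)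
qed

text \<open>The bounds are uniform in \<open>S\<close>, \<open>L\<close> and \<open>j\<close>, so
  the bounds of two premises combine by union, \<open>min\<close> and \<open>max\<close>;
  \<open>act\<close> shifts both level bounds by \<open>n\<close>.\<close>

lemma expand_gcong:
  assumes "gcong E a b"
  shows "\<exists>X L0 M. finite X \<and> (\<forall>S. X \<subseteq> S \<longrightarrow> finite S \<longrightarrow> (\<forall>L\<le>L0. \<forall>j. M \<le> L + int j \<longrightarrow>
    expand E S L j a = expand E S L j b))"
  using assms
proof induction
  case (step a b)
  then show ?case using expand_step1 by metis
next
  case (refl a)
  then show ?case by (metis finite.emptyI)
next
  case (sym a b)
  then show ?case by metis
next
  case (trans a b c)
  then obtain X L0 M X' L0' M' where *: "finite X" "finite X'"
    "\<And>S L j. X \<subseteq> S \<Longrightarrow> finite S \<Longrightarrow> L \<le> L0 \<Longrightarrow> M \<le> L + int j \<Longrightarrow>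
      expand E S L j a = expand E S L j b"
    "\<And>S L j. X' \<subseteq> S \<Longrightarrow> finite S \<Longrightarrow> L \<le> L0' \<Longrightarrow> M' \<le> L + int j \<Longrightarrow>
      expand E S L j b = expand E S L j c"
    by metis
  show ?case
    by (intro exI[of _ "X \<union> X'"] exI[of _ "min L0 L0'"] exI[of _ "max M M'"]) (auto simp: *)
next
  case (add a b c d)
  then obtain X L0 M X' L0' M' where *: "finite X" "finite X'"
    "\<And>S L j. X \<subseteq> S \<Longrightarrow> finite S \<Longrightarrow> L \<le> L0 \<Longrightarrow> M \<le> L + int j \<Longrightarrow>
      expand E S L j a = expand E S L j b"
    "\<And>S L j. X' \<subseteq> S \<Longrightarrow> finite S \<Longrightarrow> L \<le> L0' \<Longrightarrow> M' \<le> L + int j \<Longrightarrow>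
      expand E S L j c = expand E S L j d"
    by metis
  show ?case
    by (intro exI[of _ "X \<union> X'"] exI[of _ "min L0 L0'"] exI[of _ "max M M'"])
      (auto simp: * expand_add)
next
  case (act a b n)
  then obtain X L0 M where *: "finite X"
    "\<And>S L j. X \<subseteq> S \<Longrightarrow> finite S \<Longrightarrow> L \<le> L0 \<Longrightarrow> M \<le> L + int j \<Longrightarrow>
      expand E S L j a = expand E S L j b"
    by metis
  have "expand E S L j (act n a) = expand E S L j (act n b)"
    if "X \<subseteq> S" "finite S" "L \<le> L0 + n" "M + n \<le> L + int j" for S L j
  proof -
    have "act n (expand E S (L - n) j a) = act n (expand E S (L - n) j b)"
      using *(2)[of S "L - n" j] that by simp
    then show ?thesis by (simp add: act_expand)
  qed
  then show ?case using *(1) by metis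
qed


section \<open>Sizes and levels under expansion\<close>

lemma mem_advance_iff:
  "t \<in># advance E S m a \<longleftrightarrow>
    t \<in># a \<and> fst t \<noteq> m \<or> (\<exists>g. (m, g) \<in># a \<and> t \<in># unfold E S (m, g))"
  by (auto simp: advance_def split: if_splits)

lemma size_advance_ge: "size a \<le> size (advance E S m a)"
proof (induction a)
  case (add t a)
  then show ?case
    using advance_add[of E S m "{#t#}" a] size_unfold_pos[of E S t]
    by (auto simp: advance_single)
qed simp

text \<open>No monomial unfolds to nothing, so growth at one monomial cannot be offset by the
  others.\<close>

lemma size_unfold_eq_1:
  assumes "size (advance E S m a) = size a" "(m, g) \<in># a"
  shows "size (unfold E S (m, g)) = 1"
proof -
  obtain b where b: "a = {#(m, g)#} + b" using multi_member_split[OF assms(2)] by auto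
  show ?thesis
    using assms(1) size_advance_ge[of b E S m] size_unfold_pos[of E S "(m, g)"]
    unfolding b advance_add by (simp add: advance_single)
qed

text \<open>Sinks, infinite emitters and improper vertices leave a monomial at level
  \<open>k\<close>. Only a regular vertex remains, and its fan has as many terms as it emits
  edges.\<close>

lemma unfold_singleE:
  assumes "size (unfold E S (k, g)) = 1" "\<And>l h. (l, h) \<in># unfold E S (k, g) \<Longrightarrow> l \<noteq> k"
  obtains v e where "g = Proper v" "out_arcs E v = {e}"
    "unfold E S (k, g) = {#(k + 1, Proper (head E e))#}"
proof (cases g)
  case (Proper v)
  have "(k, h) \<notin># unfold E S (k, g)" for h using assms(2) by blast
  from this[of "Proper v"] this[of "Improper v (S \<inter> out_arcs E v)"]
  have "finite (out_arcs E v)" "out_arcs E v \<noteq> {}"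
    using Proper by (auto split: if_splits)
  then have "card (out_arcs E v) = 1" using assms(1) Proper by simp
  then obtain e where "out_arcs E v = {e}" by (auto simp: card_1_singleton_iff)
  with Proper that show ?thesis by simp
next
  case (Improper v Z)
  then show ?thesis using assms(2) by auto
qed

lemma expand_level_ge:
  assumes "\<And>k g. (k, g) \<in># a \<Longrightarrow> L \<le> k" "(k, g) \<in># expand E S L j a"
  shows "L \<le> k"
  using assms(2)
proof (induction j arbitrary: k g)
  case (Suc j)
  then show ?case by (auto simp: mem_advance_iff dest: mem_unfold_level)
qed (use assms(1) in auto)

lemma expand_level_le:
  assumes "\<And>k g. (k, g) \<in># a \<Longrightarrow> k \<le> K" "(k, g) \<in># expand E S L j a"
  shows "k \<le> max K (L + int j)"
  using assms(2)
proof (induction j arbitrary: k g)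
  case (Suc j)
  then show ?case by (fastforce simp: mem_advance_iff dest: mem_unfold_level)
next
  case 0
  then show ?case using assms(1)[of k g] by simp
qed

lemma expand_persistent:
  assumes "(k, g) \<in># expand E S L j a" "k < L + int j"
  shows "(k, g) \<in># expand E S L (j + i) a"
proof (induction i)
  case (Suc i)
  then show ?case using assms(2) by (simp add: mem_advance_iff)
qed (use assms(1) in simp)

lemma size_expand_mono: "i \<le> j \<Longrightarrow> size (expand E S L i a) \<le> size (expand E S L j a)"
  by (rule lift_Suc_mono_le) (simp_all add: size_advance_ge)

lemma levels_bounded: "\<exists>K. \<forall>(k, g) \<in># (a :: ('v, 'e) gmon). \<bar>k\<bar> \<le> K"
  by (intro exI[of _ "Max ((\<lambda>t. \<bar>fst t\<bar>) ` set_mset a)"]) (auto intro!: Max_ge image_eqI)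

section \<open>From periodic elements to cycles without exit\<close>

lemma periodic_expand:
  assumes "periodic E a"
  obtains S L J n where "0 < n" "\<And>k g. (k, g) \<in># a \<Longrightarrow> L \<le> k"
    "\<And>j. J \<le> j \<Longrightarrow> expand E S L (j + n) a = act (int n) (expand E S L j a)"
proof -
  obtain n' where "0 < n'" "gcong E a (act n' a)" using assms by (auto simp: periodic_def)
  then obtain n where n: "0 < n" "gcong E a (act (int n) a)"
    by (metis zero_less_imp_eq_int)
  obtain S L0 M where eq: "\<And>L j. L \<le> L0 \<Longrightarrow> M \<le> L + int j \<Longrightarrow>
      expand E S L j a = expand E S L j (act (int n) a)"
    using expand_gcong[OF n(2)] by (metis order_refl)
  obtain K where K: "\<forall>(k, g) \<in># a. \<bar>k\<bar> \<le> K" using levels_bounded by blast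
  define L where "L = min L0 (- K)"
  have L: "L \<le> k" if "(k, g) \<in># a" for k g
    using K that unfolding L_def by fastforce
  have "expand E S L (j + n) a = act (int n) (expand E S L j a)" if j: "nat (M - L) \<le> j" for j
  proof -
    have "expand E S L (j + n) a = expand E S L (j + n) (act (int n) a)"
      by (rule eq) (use j in \<open>auto simp: L_def\<close>)
    also have "\<dots> = act (int n) (expand E S (L - int n) (n + j) a)"
      by (simp add: act_expand add.commute)
    \<comment> \<open>The window now starts \<open>n\<close> levels below \<open>L\<close>, where
      \<open>a\<close> has no monomials, so its first \<open>n\<close> passes are idle.\<close>
    also have "expand E S (L - int n) (n + j) a = expand E S L j a"
      using L by (simp add: expand_split expand_below)
    finally show ?thesis .
  qed
  with n(1) L that show ?thesis by blast
qed

lemma (in wf_digraph) exitless_cycle_of_walk: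
  assumes out: "\<And>i. out_arcs G (w i) = {e i}" "\<And>i. head G (e i) = w (Suc i)"
    and rep: "\<not> inj w"
  shows "\<exists>p. cycle p \<and> \<not> has_exit G p"
proof -
  have e: "e i \<in> arcs G" "tail G (e i) = w i" for i
    using out(1)[of i] by (auto simp: out_arcs_def)
  \<comment> \<open>Quantifying over the start \<open>i\<close> lets the least \<open>d\<close>
    exclude every shorter return inside the segment, which makes its vertices distinct.\<close>
  define P where "P d \<longleftrightarrow> 0 < d \<and> (\<exists>i. w i = w (i + d))" for d
  obtain i k where "i < k" "w i = w k" using rep by (metis injI linorder_neqE_nat)
  then have "P (k - i)" by (auto simp: P_def intro!: exI[of _ i])
  define d where "d = (LEAST d. P d)"
  have "P d" unfolding d_def using \<open>P (k - i)\<close> by (rule LeastI)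
  have least: "d \<le> c" if "P c" for c unfolding d_def using that by (rule Least_le)
  obtain i where d: "0 < d" "w i = w (i + d)" using \<open>P d\<close> by (auto simp: P_def)
  define p where "p = map e [i..<i + d]"
  have walk: "awalk (w i) (map e [i..<i + c]) (w (i + c))" for c
  proof (induction c)
    case 0
    then show ?case using e[of i] by (auto simp: awalk_Nil_iff dest: tail_in_verts)
  next
    case (Suc c)
    have "awalk (w (i + c)) [e (i + c)] (w (i + Suc c))"
      using e[of "i + c"] out(2)[of "i + c"] head_in_verts[of "e (i + c)"]
      by (auto simp: awalk_Cons_iff awalk_Nil_iff)
    with Suc show ?case by (auto intro: awalk_appendI)
  qed
  have "inj_on w {i..<i + d}"
  proof (rule linorder_inj_onI)
    fix s t assume st: "s < t" "s \<in> {i..<i + d}" "t \<in> {i..<i + d}"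
    show "w s \<noteq> w t"
    proof
      assume "w s = w t"
      then have "P (t - s)" using st by (auto simp: P_def intro!: exI[of _ s])
      then show False using least[of "t - s"] st by auto
    qed
  qed auto
  then have "distinct (map (tail G) p)" by (simp add: p_def distinct_map comp_def e)
  moreover have "p \<noteq> []" "awalk (w i) p (w i)" using d walk[of d] by (auto simp: p_def)
  ultimately have "cycle p" by (auto simp: cycle_iff_distinct_tails)
  moreover have "\<not> has_exit G p" using out(1) e by (auto simp: has_exit_def p_def)
  ultimately show ?thesis by blast
qed

lemma (in wf_digraph) periodic_exitless_cycle:
  assumes "periodic G a" "a \<noteq> {#}"
  shows "\<exists>p. cycle p \<and> \<not> has_exit G p"
proof -
  obtain S L J n where n: "0 < n" and L: "\<And>k g. (k, g) \<in># a \<Longrightarrow> L \<le> k"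
    and J: "\<And>j. J \<le> j \<Longrightarrow> expand G S L (j + n) a = act (int n) (expand G S L j a)"
    using periodic_expand[OF assms(1)] by metis
  define f where "f j = expand G S L j a" for j
  have f_Suc: "f (Suc j) = advance G S (L + int j) (f j)" for j by (simp add: f_def)
  have f_period: "f (j + t * n) = act (int (t * n)) (f j)" if "J \<le> j" for j t
  proof (induction t)
    case (Suc t)
    have "f (j + Suc t * n) = f ((j + t * n) + n)" by (simp add: algebra_simps)
    also have "\<dots> = act (int n) (f (j + t * n))" using J that by (simp add: f_def)
    finally show ?case using Suc by (simp add: act_act)
  qed simp
  obtain K where K: "\<forall>(k, g) \<in># a. \<bar>k\<bar> \<le> K" using levels_bounded by blast
  \<comment> \<open>From \<open>J\<close> on the expansion is periodic; from \<open>K - L\<close> on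
    no level of \<open>a\<close> exceeds \<open>L + int j\<close>.\<close>
  define J1 where "J1 = max J (nat (K - L))"
  have level: "k = L + int j" if j: "J1 \<le> j" and k: "(k, g) \<in># f j" for j k g
  proof (rule antisym)
    have "k \<le> max K (L + int j)"
      using K k unfolding f_def by (intro expand_level_le) fastforce+
    moreover have "K \<le> L + int j" using j by (simp add: J1_def nat_le_iff)
    ultimately show "k \<le> L + int j" by simp
    show "L + int j \<le> k"
    proof (rule ccontr)
      assume "\<not> L + int j \<le> k"
      \<comment> \<open>a monomial left behind stays forever, but the periodicity moves all levels up\<close>
      define t where "t = Suc (nat (k - L))"
      have "(k, g) \<in># f (j + t * n)"
        using \<open>\<not> L + int j \<le> k\<close> k unfolding f_def by (intro expand_persistent) auto
      then have "(k - int (t * n), g) \<in># expand G S L j a"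
        using f_period[of j t] j by (simp add: mem_act_iff J1_def f_def)
      with L have "L \<le> k - int (t * n)" by (rule expand_level_ge)
      moreover have "t * 1 \<le> t * n" using n by (intro mult_le_mono2) simp
      then have "int t \<le> int (t * n)" by linarith
      moreover have "k - L < int t" by (simp add: t_def)
      ultimately show False by linarith
    qed
  qed
  \<comment> \<open>The size never drops and returns to the same value after
    \<open>n \<ge> 1\<close> passes, so it cannot grow in between.\<close>
  have size: "size (f (Suc j)) = size (f j)" if "J1 \<le> j" for j
  proof -
    have "size (f (Suc j)) \<le> size (f (j + 1 * n))"
      unfolding f_def using n by (intro size_expand_mono) simp
    also have "\<dots> = size (f j)" using f_period[of j 1] that by (simp add: J1_def)
    finally show ?thesis using size_advance_ge[of "f j" G S "L + int j"] by (simp add: f_Suc)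
  qed
  \<comment> \<open>By \<open>level\<close> the unfolding leaves nothing behind on level
    \<open>L + int j\<close>, and by \<open>size\<close> it is a single monomial.\<close>
  have succ: "\<exists>v e. g = Proper v \<and> out_arcs G v = {e} \<and>
      (L + int (Suc j), Proper (head G e)) \<in># f (Suc j)"
    if j: "J1 \<le> j" and g: "(L + int j, g) \<in># f j" for j g
  proof -
    have sub: "t \<in># f (Suc j)" if "t \<in># unfold G S (L + int j, g)" for t
      using that g by (auto simp: f_Suc mem_advance_iff)
    have "size (unfold G S (L + int j, g)) = 1"
      using size[OF j] g unfolding f_Suc by (rule size_unfold_eq_1)
    moreover have "l \<noteq> L + int j" if "(l, h) \<in># unfold G S (L + int j, g)" for l h
      using level[of "Suc j" l h] sub[OF that] j by simp
    ultimately obtain v e where "g = Proper v" "out_arcs G v = {e}"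
      "unfold G S (L + int j, g) = {#(L + int j + 1, Proper (head G e))#}"
      by (rule unfold_singleE)
    then show ?thesis using sub by (auto simp: algebra_simps)
  qed
  have "size a \<le> size (f J1)" using size_expand_mono[of 0 J1 G S L a] by (simp add: f_def)
  then have "f J1 \<noteq> {#}" using assms(2) by auto
  then obtain k g where "(k, g) \<in># f J1" by (metis multiset_nonemptyE surj_pair)
  then have "(L + int J1, g) \<in># f J1" using level by blast
  then obtain v0 where v0: "(L + int J1, Proper v0) \<in># f J1" using succ by blast
  define arc where "arc v = the_elem (out_arcs G v)" for v
  define w where "w i = ((\<lambda>v. head G (arc v)) ^^ i) v0" for i
  have w: "(L + int (J1 + i), Proper (w i)) \<in># f (J1 + i)" for i
  proof (induction i)
    case (Suc i)
    have "w (Suc i) = head G (arc (w i))" by (simp add: w_def)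
    with succ[OF le_add1 Suc] show ?case by (auto simp: arc_def)
  qed (simp add: v0 w_def)
  have out: "out_arcs G (w i) = {arc (w i)}" for i
  proof -
    obtain e where "out_arcs G (w i) = {e}" using succ[OF le_add1 w[of i]] by blast
    then show ?thesis by (simp add: arc_def)
  qed
  \<comment> \<open>\<open>f (J1 + t * n)\<close> is \<open>f J1\<close> shifted by
    \<open>t * n\<close>, so the vertices of \<open>w\<close> at multiples of \<open>n\<close> all
    occur in one finite multiset, which forces a repetition.\<close>
  have "Proper (w (t * n)) \<in> snd ` set_mset (f J1)" for t
  proof -
    have "(L + int (J1 + t * n) - int (t * n), Proper (w (t * n))) \<in># f J1"
      using w[of "t * n"] f_period[of J1 t] unfolding mem_act_iff[symmetric] by (simp add: J1_def)
    then show ?thesis by (rule image_eqI[rotated]) simp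
  qed
  then have "range (\<lambda>t. w (t * n)) \<subseteq> Proper -` snd ` set_mset (f J1)" by blast
  moreover have "finite (Proper -` snd ` set_mset (f J1))"
    by (intro finite_vimageI) (auto intro: injI)
  ultimately have "finite (range (\<lambda>t. w (t * n)))" by (rule finite_subset)
  then have "\<not> inj (\<lambda>t. w (t * n))" using finite_imageD infinite_UNIV_nat by blast
  then obtain s t where "w (s * n) = w (t * n)" "s \<noteq> t" by (auto simp: inj_def)
  then have "\<not> inj w" using n by (auto dest: injD)
  then show ?thesis
    using out by (intro exitless_cycle_of_walk[of w "\<lambda>i. arc (w i)"]) (simp_all add: w_def)
qed

theorem corollary5p3:
  fixes E :: "('v, 'e) pre_digraph"
  assumes "wf_digraph E"
  shows "(\<forall>a \<in> graph_gmonoid E. a \<noteq> {#} \<longrightarrow> \<not> periodic E a) \<longleftrightarrow> condition_L E"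
proof -
  interpret wf_digraph E by (fact assms)
  show ?thesis
    unfolding condition_L_def using exitless_cycle_periodic periodic_exitless_cycle by metis
qed

end
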